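(* Let $\mathcal{F}$ be a free filter on $\mathbb{N}$. If $\mathcal{F}$ is diagonal and block-respecting, then $\mathcal{F}$ has the Schur property.
   Context: A filter on $\mathbb{N}$ is free if it contains all subsets of $\mathbb{N}$ with finite complement. A sequence $(x_n)_{n\in\mathbb{N}}$ in a topological space $\mathcal{F}$-converges to $x$ if $\{n: x_n\in U\}\in\mathcal{F}$ for every neighborhood $U$ of $x$. A set $I\subset\mathbb{N}$ is $\mathcal{F}$-stationary if $I\cap A\neq\emptyset$ for every $A\in\mathcal{F}$; $\mathcal{F}^*$ denotes the collection of all $\mathcal{F}$-stationary sets. The space $\ell_1$ is the real Banach space of absolutely summable sequences. $\mathcal{F}$ has the Schur property if for every sequence $(x_n)_{n\in\mathbb{N}}\subset\ell_1$ that $\mathcal{F}$-converges to $0$ in the weak topology of $\ell_1$, one has $\mathcal{F}\text{-}\lim\|x_n\|=0$. $\mathcal{F}$ is diagonal if for every decreasing sequence $A_1\supset A_2\supset\cdots$ of elements of $\mathcal{F}$ and every $I\in\mathcal{F}^*$ there is $J\in\mathcal{F}^*$, $J\subset I$, such that $|J\setminus A_n|<\infty$ for all $n\in\mathbb{N}$. A blocking of an infinite set $I\subset\mathbb{N}$ is a partition $D=\{D_k\}_{k\in\mathbb{N}}$ of $I$ into pairwise disjoint non-empty finite subsets. $\mathcal{F}$ is block-respecting if for every $I\in\mathcal{F}^*$ and every blocking $D=\{D_k\}_{k\in\mathbb{N}}$ of $I$ there is $J\in\mathcal{F}^*$, $J\subset I$, such that $|J\cap D_k|=1$ for all $k$.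 *)

theory Defs
  imports "HOL-Analysis.Analysis"
begin

typedef ell1 = "{x :: nat \<Rightarrow> real. summable (\<lambda>i. \<bar>x i\<bar>)}"
  morphisms coord Ell1
  by (rule exI[of _ "\<lambda>_. 0"]) simp

setup_lifting type_definition_ell1

lemma summable_coord: "summable (\<lambda>i. \<bar>coord x i\<bar>)"
  using coord[of x] by simp

lemma ell1_eqI: "(\<And>i. coord x i = coord y i) \<Longrightarrow> x = y"
  by (simp add: coord_inject[symmetric] ext)

lemma summable_abs_add:
  fixes f g :: "nat \<Rightarrow> real"
  assumes "summable (\<lambda>i. \<bar>f i\<bar>)" "summable (\<lambda>i. \<bar>g i\<bar>)"
  shows "summable (\<lambda>i. \<bar>f i + g i\<bar>)"
  by (rule summable_comparison_test'[OF summable_add[OF assms], of 0]) simp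

lemma summable_abs_diff:
  fixes f g :: "nat \<Rightarrow> real"
  assumes "summable (\<lambda>i. \<bar>f i\<bar>)" "summable (\<lambda>i. \<bar>g i\<bar>)"
  shows "summable (\<lambda>i. \<bar>f i - g i\<bar>)"
  using summable_abs_add[of f "\<lambda>i. - g i"] assms by simp

instantiation ell1 :: real_normed_vector
begin

lift_definition zero_ell1 :: ell1 is "\<lambda>_. 0" by simp
lift_definition plus_ell1 :: "ell1 \<Rightarrow> ell1 \<Rightarrow> ell1" is "\<lambda>x y i. x i + y i"
  by (rule summable_abs_add)
lift_definition minus_ell1 :: "ell1 \<Rightarrow> ell1 \<Rightarrow> ell1" is "\<lambda>x y i. x i - y i"
  by (rule summable_abs_diff)
lift_definition uminus_ell1 :: "ell1 \<Rightarrow> ell1" is "\<lambda>x i. - x i" by simp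
lift_definition scaleR_ell1 :: "real \<Rightarrow> ell1 \<Rightarrow> ell1" is "\<lambda>c x i. c * x i"
  by (simp add: abs_mult summable_mult)
lift_definition norm_ell1 :: "ell1 \<Rightarrow> real" is "\<lambda>x. \<Sum>i. \<bar>x i\<bar>" .

definition sgn_ell1 :: "ell1 \<Rightarrow> ell1" where "sgn_ell1 x = inverse (norm x) *\<^sub>R x"
definition dist_ell1 :: "ell1 \<Rightarrow> ell1 \<Rightarrow> real" where "dist_ell1 x y = norm (x - y)"
definition uniformity_ell1 :: "(ell1 \<times> ell1) filter"
  where "uniformity_ell1 = (INF e\<in>{0 <..}. principal {(x, y). dist x y < e})"
definition open_ell1 :: "ell1 set \<Rightarrow> bool"
  where "open_ell1 S = (\<forall>x\<in>S. \<forall>\<^sub>F (x', y) in uniformity. x' = x \<longrightarrow> y \<in> S)"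

instance
proof
  fix x y z :: ell1 and a b :: real
  show "x + y + z = x + (y + z)" by transfer (simp add: add.assoc)
  show "x + y = y + x" by transfer (simp add: add.commute)
  show "0 + x = x" by transfer simp
  show "- x + x = 0" by transfer simp
  show "x - y = x + - y" by transfer simp
  show "a *\<^sub>R (x + y) = a *\<^sub>R x + a *\<^sub>R y" by transfer (simp add: distrib_left)
  show "(a + b) *\<^sub>R x = a *\<^sub>R x + b *\<^sub>R x" by transfer (simp add: distrib_right)
  show "a *\<^sub>R b *\<^sub>R x = (a * b) *\<^sub>R x" by transfer (simp add: mult.assoc)
  show "1 *\<^sub>R x = x" by transfer simp
  show "norm x = 0 \<longleftrightarrow> x = 0"
    by transfer (auto simp: suminf_eq_zero_iff)
  show "norm (x + y) \<le> norm x + norm y"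
  proof transfer
    fix x y :: "nat \<Rightarrow> real"
    assume s: "summable (\<lambda>i. \<bar>x i\<bar>)" "summable (\<lambda>i. \<bar>y i\<bar>)"
    have "(\<Sum>i. \<bar>x i + y i\<bar>) \<le> (\<Sum>i. \<bar>x i\<bar> + \<bar>y i\<bar>)"
      by (intro suminf_le summable_abs_add summable_add s) simp
    then show "(\<Sum>i. \<bar>x i + y i\<bar>) \<le> (\<Sum>i. \<bar>x i\<bar>) + (\<Sum>i. \<bar>y i\<bar>)"
      by (simp add: suminf_add s)
  qed
  show "norm (a *\<^sub>R x) = \<bar>a\<bar> * norm x"
    by transfer (simp add: abs_mult suminf_mult)
qed (rule sgn_ell1_def dist_ell1_def uniformity_ell1_def open_ell1_def)+

end

lemma sum_abs_coord_le_norm: "(\<Sum>i<n. \<bar>coord x i\<bar>) \<le> norm x"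
  unfolding norm_ell1.rep_eq by (rule sum_le_suminf[OF summable_coord]) auto

lemma abs_coord_le_norm: "\<bar>coord x i\<bar> \<le> norm x"
proof -
  have "\<bar>coord x i\<bar> \<le> (\<Sum>j<Suc i. \<bar>coord x j\<bar>)" by (simp add: sum_nonneg)
  then show ?thesis using sum_abs_coord_le_norm order_trans by blast
qed

instance ell1 :: banach
proof
  fix X :: "nat \<Rightarrow> ell1"
  assume X: "Cauchy X"
  have "Cauchy (\<lambda>n. coord (X n) i)" for i
  proof (rule metric_CauchyI)
    fix e :: real assume "e > 0"
    from metric_CauchyD[OF X this] obtain M
      where M: "\<And>m n. m \<ge> M \<Longrightarrow> n \<ge> M \<Longrightarrow> dist (X m) (X n) < e" by blast
    have "dist (coord (X m) i) (coord (X n) i) < e" if "m \<ge> M" "n \<ge> M" for m n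
      using abs_coord_le_norm[of "X m - X n" i] M[OF that]
      by (simp add: dist_norm minus_ell1.rep_eq)
    then show "\<exists>M. \<forall>m\<ge>M. \<forall>n\<ge>M. dist (coord (X m) i) (coord (X n) i) < e" by blast
  qed
  then have "\<forall>i. \<exists>l. (\<lambda>n. coord (X n) i) \<longlonglongrightarrow> l"
    by (simp add: Cauchy_convergent_iff convergent_def)
  then obtain l where l: "\<And>i. (\<lambda>n. coord (X n) i) \<longlonglongrightarrow> l i" by metis
  have tail: "\<exists>M. \<forall>m\<ge>M. summable (\<lambda>i. \<bar>coord (X m) i - l i\<bar>) \<and> (\<Sum>i. \<bar>coord (X m) i - l i\<bar>) \<le> e"
    if "e > 0" for e
  proof -
    from metric_CauchyD[OF X that] obtain M
      where M: "\<And>m n. m \<ge> M \<Longrightarrow> n \<ge> M \<Longrightarrow> dist (X m) (X n) < e" by blast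
    have part: "(\<Sum>i<k. \<bar>coord (X m) i - l i\<bar>) \<le> e" if m: "m \<ge> M" for m k
    proof (rule tendsto_upperbound)
      show "(\<lambda>n. \<Sum>i<k. \<bar>coord (X m) i - coord (X n) i\<bar>) \<longlonglongrightarrow> (\<Sum>i<k. \<bar>coord (X m) i - l i\<bar>)"
        by (intro tendsto_intros l)
      have "(\<Sum>i<k. \<bar>coord (X m) i - coord (X n) i\<bar>) \<le> e" if "n \<ge> M" for n
        using sum_abs_coord_le_norm[of "X m - X n" k] M[OF m that]
        by (simp add: dist_norm minus_ell1.rep_eq)
      then show "\<forall>\<^sub>F n in sequentially. (\<Sum>i<k. \<bar>coord (X m) i - coord (X n) i\<bar>) \<le> e"
        using eventually_sequentially by blast
    qed simp
    have "summable (\<lambda>i. \<bar>coord (X m) i - l i\<bar>) \<and> (\<Sum>i. \<bar>coord (X m) i - l i\<bar>) \<le> e"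
      if "m \<ge> M" for m
    proof
      show s: "summable (\<lambda>i. \<bar>coord (X m) i - l i\<bar>)"
        by (rule summableI_nonneg_bounded[where x = e]) (use part[OF that] in auto)
      show "(\<Sum>i. \<bar>coord (X m) i - l i\<bar>) \<le> e"
        by (rule suminf_le_const[OF s part[OF that]])
    qed
    then show ?thesis by blast
  qed
  obtain M where "summable (\<lambda>i. \<bar>coord (X M) i - l i\<bar>)"
    using tail[of 1] by auto
  from summable_abs_diff[OF summable_coord[of "X M"] this]
  have "summable (\<lambda>i. \<bar>l i\<bar>)" by simp
  then have L: "coord (Ell1 l) = l" by (simp add: Ell1_inverse)
  have "X \<longlonglongrightarrow> Ell1 l"
  proof (rule metric_LIMSEQ_I)
    fix e :: real assume "e > 0"
    then obtain M where "\<forall>m\<ge>M. (\<Sum>i. \<bar>coord (X m) i - l i\<bar>) \<le> e / 2"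
      using tail[of "e / 2"] by auto
    then have "\<forall>m\<ge>M. dist (X m) (Ell1 l) \<le> e / 2"
      by (simp add: dist_norm norm_ell1.rep_eq minus_ell1.rep_eq L)
    with \<open>e > 0\<close> show "\<exists>M. \<forall>m\<ge>M. dist (X m) (Ell1 l) < e" by force
  qed
  then show "convergent X" by (rule convergentI)
qed

definition weak_topology :: "'a::real_normed_vector topology"
  where "weak_topology =
    topology_generated_by {f -` U | (f :: 'a \<Rightarrow> real) U. bounded_linear f \<and> open U}"

text \<open>
  A filter of sets is represented by the library type \<^typ>\<open>nat filter\<close>; membership of \<open>A\<close> in
  the filter is \<open>\<forall>\<^sub>F n in F. n \<in> A\<close>. The library type also contains the improper filter
  \<^term>\<open>bot\<close>, which has the empty set as a member; it is excluded here.
\<close>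

definition filter_sets :: "nat filter \<Rightarrow> nat set set"
  where "filter_sets F = {A. \<forall>\<^sub>F n in F. n \<in> A}"

definition free_filter :: "nat filter \<Rightarrow> bool"
  where "free_filter F \<longleftrightarrow> F \<noteq> bot \<and> (\<forall>A. finite (- A) \<longrightarrow> A \<in> filter_sets F)"

definition stationary_sets :: "nat filter \<Rightarrow> nat set set"
  where "stationary_sets F = {I. \<forall>A\<in>filter_sets F. I \<inter> A \<noteq> {}}"

definition schur_filter :: "nat filter \<Rightarrow> bool"
  where "schur_filter F \<longleftrightarrow>
    (\<forall>x :: nat \<Rightarrow> ell1. limitin weak_topology x 0 F \<longrightarrow> ((\<lambda>n. norm (x n)) \<longlongrightarrow> 0) F)"

definition diagonal_filter :: "nat filter \<Rightarrow> bool"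
  where "diagonal_filter F \<longleftrightarrow>
    (\<forall>A :: nat \<Rightarrow> nat set. \<forall>I \<in> stationary_sets F.
      decseq A \<and> range A \<subseteq> filter_sets F \<longrightarrow>
      (\<exists>J \<in> stationary_sets F. J \<subseteq> I \<and> (\<forall>n. finite (J - A n))))"

definition blocking :: "nat set \<Rightarrow> (nat \<Rightarrow> nat set) \<Rightarrow> bool"
  where "blocking I D \<longleftrightarrow>
    infinite I \<and> disjoint_family D \<and> (\<Union>k. D k) = I \<and> (\<forall>k. finite (D k) \<and> D k \<noteq> {})"

definition block_respecting :: "nat filter \<Rightarrow> bool"
  where "block_respecting F \<longleftrightarrow>
    (\<forall>I \<in> stationary_sets F. \<forall>D. blocking I D \<longrightarrow>
      (\<exists>J \<in> stationary_sets F. J \<subseteq> I \<and> (\<forall>k. card (J \<inter> D k) = 1)))"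

end

(* If the norms do not tend to 0, then the indices n with norm (x n) \<ge> e form a stationary set.
   Diagonality shrinks it to a stationary set along which every initial segment of coordinates
   becomes small in the ordinary sense, so that a gliding hump argument splits it into
   consecutive finite blocks: vectors from the k-th block are concentrated on {m k..<m (k+2)}.
   Block-respecting leaves a stationary set with one vector per block, and one of the two parity
   classes of blocks is still stationary. There the humps are disjoint, and a single sequence of
   signs gives a functional that is at least e/2 on a stationary set of the x n. *)
theory Submission
  imports Defs
begin

section \<open>Stationary sets of a filter\<close>

text \<open>A set misses some member of \<open>F\<close> exactly when its complement belongs to
  \<open>F\<close>. In the form with \<open>frequently\<close>, it is immediate that a stationary
  union of two sets has a stationary part.\<close>

lemma stationary_sets_iff_frequently: "I \<in> stationary_sets F \<longleftrightarrow> (\<exists>\<^sub>F n in F. n \<in> I)"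
proof
  assume I: "I \<in> stationary_sets F"
  show "\<exists>\<^sub>F n in F. n \<in> I"
  proof (rule ccontr)
    assume "\<not> ?thesis"
    then have "- I \<in> filter_sets F" by (simp add: filter_sets_def not_frequently)
    with I show False by (auto simp: stationary_sets_def)
  qed
next
  assume I: "\<exists>\<^sub>F n in F. n \<in> I"
  have "I \<inter> A \<noteq> {}" if "A \<in> filter_sets F" for A
    using frequently_eventually_frequently[OF I, of "\<lambda>n. n \<in> A"] that
    by (auto simp: filter_sets_def dest: frequently_ex)
  then show "I \<in> stationary_sets F" by (simp add: stationary_sets_def)
qed

lemma infinite_stationary:
  assumes "free_filter F" "I \<in> stationary_sets F"
  shows "infinite I"
proof
  assume "finite I"
  then have "- I \<in> filter_sets F" using assms(1) by (simp add: free_filter_def)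
  with assms(2) show False by (auto simp: stationary_sets_def)
qed

section \<open>Weak convergence and functionals on the space of summable sequences\<close>

lemma limitin_weak_topology_imp_tendsto:
  fixes x :: "'b \<Rightarrow> 'a::real_normed_vector" and f :: "'a \<Rightarrow> real"
  assumes "limitin weak_topology x l F" "bounded_linear f"
  shows "((\<lambda>n. f (x n)) \<longlongrightarrow> f l) F"
proof (rule topological_tendstoI)
  fix U :: "real set" assume "open U" "f l \<in> U"
  then have "openin weak_topology (f -` U)"
    unfolding weak_topology_def using assms(2) by (intro topology_generated_by_Basis) blast
  with assms(1) \<open>f l \<in> U\<close> show "\<forall>\<^sub>F n in F. f (x n) \<in> U"
    by (auto simp: limitin_def)
qed

lemma bounded_linear_coord: "bounded_linear (\<lambda>x. coord x i)"
  by (rule bounded_linear_intro[where K = 1])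
    (simp_all add: plus_ell1.rep_eq scaleR_ell1.rep_eq abs_coord_le_norm)

lemma summable_mult_coord:
  fixes a :: "nat \<Rightarrow> real"
  assumes "\<And>i. \<bar>a i\<bar> \<le> 1"
  shows "summable (\<lambda>i. \<bar>a i * coord x i\<bar>)"
  by (rule summable_comparison_test'[OF summable_coord[of x], of 0])
    (simp add: abs_mult assms mult_left_le_one_le)

text \<open>The part of the duality with bounded sequences that is needed: the unit ball of sup-norm
  sequences acts by functionals of norm at most 1.\<close>

lemma bounded_linear_suminf_coord:
  fixes a :: "nat \<Rightarrow> real"
  assumes a: "\<And>i. \<bar>a i\<bar> \<le> 1"
  shows "bounded_linear (\<lambda>x. \<Sum>i. a i * coord x i)"
proof (rule bounded_linear_intro[where K = 1])
  note s = summable_rabs_cancel[OF summable_mult_coord[OF a]]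
  fix x y :: ell1 and r :: real
  show "(\<Sum>i. a i * coord (x + y) i) = (\<Sum>i. a i * coord x i) + (\<Sum>i. a i * coord y i)"
    by (simp add: plus_ell1.rep_eq distrib_left suminf_add[OF s s])
  show "(\<Sum>i. a i * coord (r *\<^sub>R x) i) = r *\<^sub>R (\<Sum>i. a i * coord x i)"
    by (simp add: scaleR_ell1.rep_eq mult.left_commute suminf_mult[OF s])
  have "\<bar>\<Sum>i. a i * coord x i\<bar> \<le> (\<Sum>i. \<bar>a i * coord x i\<bar>)"
    by (rule summable_rabs[OF summable_mult_coord[OF a]])
  also have "\<dots> \<le> (\<Sum>i. \<bar>coord x i\<bar>)"
    by (intro suminf_le summable_mult_coord[OF a] summable_coord)
      (simp add: abs_mult a mult_left_le_one_le)
  finally show "norm (\<Sum>i. a i * coord x i) \<le> norm x * 1"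
    by (simp add: norm_ell1.rep_eq)
qed

text \<open>The defect \<open>\<bar>coord x i\<bar> - a i * coord x i\<close> vanishes on the window
  from \<open>p\<close> to \<open>q\<close>, where the signs match, and is at most
  \<open>2 * \<bar>coord x i\<bar>\<close> elsewhere. So at most twice the mass outside the window
  is lost.\<close>

lemma suminf_signs_ge:
  fixes a :: "nat \<Rightarrow> real"
  assumes a: "\<And>i. \<bar>a i\<bar> \<le> 1"
    and sgn: "\<And>i. p \<le> i \<Longrightarrow> i < q \<Longrightarrow> a i = sgn (coord x i)"
    and "p \<le> q"
  shows "(\<Sum>i. a i * coord x i)
    \<ge> norm x - 2 * ((\<Sum>i<p. \<bar>coord x i\<bar>) + (\<Sum>i. \<bar>coord x (i + q)\<bar>))"
proof -
  define d where "d i = \<bar>coord x i\<bar> - a i * coord x i" for i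
  note sa = summable_rabs_cancel[OF summable_mult_coord[of a x, OF a]]
  have sd: "summable d"
    unfolding d_def by (intro summable_diff summable_coord sa)
  have d_le: "d i \<le> 2 * \<bar>coord x i\<bar>" for i
  proof -
    have "\<bar>a i * coord x i\<bar> \<le> \<bar>coord x i\<bar>"
      by (simp add: abs_mult a mult_left_le_one_le)
    then show ?thesis unfolding d_def by linarith
  qed
  have d0: "d i = 0" if "p \<le> i" "i < q" for i
    using sgn[OF that] by (simp add: d_def abs_sgn mult.commute)
  have "norm x - (\<Sum>i. a i * coord x i) = suminf d"
    unfolding d_def norm_ell1.rep_eq by (rule suminf_diff[OF summable_coord sa])
  also have "\<dots> = (\<Sum>i. d (i + q)) + (\<Sum>i<q. d i)"
    by (rule suminf_split_initial_segment[OF sd])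
  also have "(\<Sum>i<q. d i) = (\<Sum>i<p. d i)"
    using \<open>p \<le> q\<close> d0 by (intro sum.mono_neutral_right) auto
  also have "\<dots> \<le> (\<Sum>i<p. 2 * \<bar>coord x i\<bar>)"
    by (intro sum_mono d_le)
  also have "(\<Sum>i. d (i + q)) \<le> (\<Sum>i. 2 * \<bar>coord x (i + q)\<bar>)"
    by (intro suminf_le summable_mult summable_ignore_initial_segment summable_coord sd d_le)
  also have "(\<Sum>i. 2 * \<bar>coord x (i + q)\<bar>) = 2 * (\<Sum>i. \<bar>coord x (i + q)\<bar>)"
    by (intro suminf_mult summable_ignore_initial_segment summable_coord)
  finally show ?thesis by (simp add: sum_distrib_left)
qed

section \<open>Gliding hump and blocks\<close>

lemma norm_tail_tendsto_0: "(\<lambda>q. \<Sum>i. \<bar>coord x (i + q)\<bar>) \<longlonglongrightarrow> 0"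
  by (rule suminf_exist_split2[OF summable_coord])

lemma ex_mono_tail_bound:
  fixes x :: "nat \<Rightarrow> ell1"
  assumes "0 < d"
  obtains M where "mono M" "\<And>n j. j \<le> n \<Longrightarrow> (\<Sum>i. \<bar>coord (x j) (i + M n)\<bar>) < d"
proof -
  have "\<exists>q. \<forall>r\<ge>q. (\<Sum>i. \<bar>coord (x j) (i + r)\<bar>) < d" for j
    using order_tendstoD(2)[OF norm_tail_tendsto_0[of "x j"] assms]
    by (simp add: eventually_sequentially)
  then obtain Q where Q: "\<And>j r. Q j \<le> r \<Longrightarrow> (\<Sum>i. \<bar>coord (x j) (i + r)\<bar>) < d" by metis
  show thesis
  proof (rule that)
    \<comment> \<open>Summing the individual thresholds gives a cutoff that is monotone in
      \<open>n\<close> and dominates \<open>Q j\<close> for every \<open>j \<le> n\<close>.\<close>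
    show "mono (\<lambda>n. \<Sum>j\<le>n. Q j)" by (auto intro!: monoI sum_mono2)
    show "(\<Sum>i. \<bar>coord (x j) (i + (\<Sum>j\<le>n. Q j))\<bar>) < d" if "j \<le> n" for n j
      using that by (intro Q member_le_sum) auto
  qed
qed

lemma blocking_of_strict_mono:
  fixes N :: "nat \<Rightarrow> nat"
  assumes "strict_mono N" "N 0 = 0" "infinite J" "\<And>k. \<exists>j\<in>J. N k \<le> j \<and> j < N (Suc k)"
  shows "blocking J (\<lambda>k. J \<inter> {N k..<N (Suc k)})"
  unfolding blocking_def
proof (intro conjI allI)
  show "disjoint_family (\<lambda>k. J \<inter> {N k..<N (Suc k)})"
    unfolding disjoint_family_on_def
  proof (intro ballI impI)
    fix k l :: nat assume "k \<noteq> l"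
    then have "N (Suc k) \<le> N l \<or> N (Suc l) \<le> N k"
      using assms(1) by (auto simp: strict_mono_less_eq)
    then show "(J \<inter> {N k..<N (Suc k)}) \<inter> (J \<inter> {N l..<N (Suc l)}) = {}" by auto
  qed
  show "(\<Union>k. J \<inter> {N k..<N (Suc k)}) = J"
  proof (intro equalityI subsetI)
    fix j assume "j \<in> J"
    \<comment> \<open>Minimality of \<open>k\<close> puts \<open>j\<close> at or above
      \<open>N k\<close>; for \<open>k = 0\<close> this is \<open>N 0 = 0\<close>.\<close>
    define k where "k = (LEAST k. j < N (Suc k))"
    have "j < N (Suc j)"
      using strict_mono_imp_increasing[OF assms(1), of "Suc j"] by simp
    then have k: "j < N (Suc k)" unfolding k_def by (rule LeastI)
    have "N k \<le> j"
    proof (cases k)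
      case (Suc l)
      then show ?thesis using not_less_Least[of l "\<lambda>k. j < N (Suc k)"] by (simp add: k_def)
    qed (simp add: assms(2))
    with k \<open>j \<in> J\<close> show "j \<in> (\<Union>k. J \<inter> {N k..<N (Suc k)})" by auto
  qed auto
  show "J \<inter> {N k..<N (Suc k)} \<noteq> {}" for k
    using assms(4)[of k] by auto
qed (simp_all add: assms(3))

text \<open>The tail cutoff of a block can be fixed only once the end of the block is known, and
  heads up to that cutoff are small only one block later. Hence windows span two steps of
  \<open>m\<close>, and those of neighbouring blocks may overlap.\<close>

lemma ex_gliding_hump_blocking:
  fixes x :: "nat \<Rightarrow> ell1"
  assumes "infinite J" "0 < d"
    and head: "\<And>p. finite {j\<in>J. \<not> (\<Sum>i<p. \<bar>coord (x j) i\<bar>) < d}"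
  obtains D :: "nat \<Rightarrow> nat set" and m :: "nat \<Rightarrow> nat"
  where "blocking J D" "mono m"
    "\<And>k j. j \<in> D k \<Longrightarrow> (\<Sum>i<m k. \<bar>coord (x j) i\<bar>) < d"
    "\<And>k j. j \<in> D k \<Longrightarrow> (\<Sum>i. \<bar>coord (x j) (i + m (k + 2))\<bar>) < d"
proof -
  obtain M where M: "mono M" "\<And>n j. j \<le> n \<Longrightarrow> (\<Sum>i. \<bar>coord (x j) (i + M n)\<bar>) < d"
    using ex_mono_tail_bound[OF assms(2)] by metis
  \<comment> \<open>The bound \<open>r\<close> must leave room for an element of \<open>J\<close>
    from \<open>n\<close> on, so that the block is non-empty, and lie beyond the finitely many
    elements of \<open>J\<close> with a large head up to \<open>M n\<close>.\<close>
  have "\<exists>r. (\<exists>j\<in>J. n \<le> j \<and> j < r) \<and> (\<forall>j\<in>J. r \<le> j \<longrightarrow> (\<Sum>i<M n. \<bar>coord (x j) i\<bar>) < d)" for n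
  proof -
    obtain j where j: "j \<in> J" "n \<le> j"
      using assms(1) by (meson infinite_nat_iff_unbounded_le)
    obtain b where b: "\<And>j. j \<in> J \<Longrightarrow> \<not> (\<Sum>i<M n. \<bar>coord (x j) i\<bar>) < d \<Longrightarrow> j < b"
      using head[of "M n"] by (auto simp: finite_nat_set_iff_bounded)
    with j show ?thesis
      using b by (intro exI[of _ "max (Suc j) b"]) force
  qed
  then obtain P where P: "\<And>n. \<exists>j\<in>J. n \<le> j \<and> j < P n"
    "\<And>n j. j \<in> J \<Longrightarrow> P n \<le> j \<Longrightarrow> (\<Sum>i<M n. \<bar>coord (x j) i\<bar>) < d" by metis
  define N where "N k = (P ^^ k) 0" for k
  have NS: "N (Suc k) = P (N k)" for k by (simp add: N_def)
  have N: "strict_mono N"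
    unfolding strict_mono_Suc_iff NS using P(1) le_less_trans by blast
  \<comment> \<open>With this shift, \<open>m (k + 2) = M (N (Suc k))\<close> controls the tails of
    block \<open>k\<close>. For \<open>k = Suc l\<close>, \<open>m k = M (N l)\<close> controls its
    heads, as the block starts at \<open>P (N l)\<close>. The value \<open>m 0 = 0\<close> makes the
    heads of the first block empty.\<close>
  define m where "m k = (case k of 0 \<Rightarrow> 0 | Suc l \<Rightarrow> M (N l))" for k
  show thesis
  proof (rule that)
    show "blocking J (\<lambda>k. J \<inter> {N k..<N (Suc k)})"
      using P(1) by (intro blocking_of_strict_mono N assms(1)) (simp_all add: N_def)
    have "m k \<le> m (Suc k)" for k
      using monoD[OF M(1)] N by (auto simp: m_def strict_mono_less_eq split: nat.split)
    then show "mono m" by (simp add: mono_iff_le_Suc)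
    show "(\<Sum>i<m k. \<bar>coord (x j) i\<bar>) < d" if "j \<in> J \<inter> {N k..<N (Suc k)}" for k j
      using that P(2) assms(2) by (cases k) (auto simp: m_def NS)
    show "(\<Sum>i. \<bar>coord (x j) (i + m (k + 2))\<bar>) < d" if "j \<in> J \<inter> {N k..<N (Suc k)}" for k j
      using that M(2)[of j "N (Suc k)"] by (simp add: m_def)
  qed
qed

section \<open>Signs on disjoint windows\<close>

lemma ex_signs_on_disjoint:
  fixes y :: "'k \<Rightarrow> 'i \<Rightarrow> real"
  assumes "disjoint_family_on H K"
  obtains a :: "'i \<Rightarrow> real"
  where "\<And>i. \<bar>a i\<bar> \<le> 1" "\<And>k i. k \<in> K \<Longrightarrow> i \<in> H k \<Longrightarrow> a i = sgn (y k i)"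
proof
  \<comment> \<open>Disjointness makes the chosen index unique wherever a sign is prescribed.
    Outside all windows the choice is arbitrary, which is harmless because any value of
    \<open>sgn\<close> is bounded by 1.\<close>
  define \<kappa> where "\<kappa> i = (SOME k. k \<in> K \<and> i \<in> H k)" for i
  show "\<bar>sgn (y (\<kappa> i) i)\<bar> \<le> 1" for i by (simp add: abs_sgn_eq)
  show "sgn (y (\<kappa> i) i) = sgn (y k i)" if "k \<in> K" "i \<in> H k" for k i
  proof -
    have "\<kappa> i \<in> K \<and> i \<in> H (\<kappa> i)" unfolding \<kappa>_def by (rule someI) (use that in blast)
    then have "\<kappa> i = k" using assms that by (auto simp: disjoint_family_on_def)
    then show ?thesis by simp
  qed
qed

text \<open>Distinct indices of equal parity differ by at least 2, the width of a window in steps of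
  \<open>m\<close>.\<close>

lemma disjoint_family_on_same_parity:
  fixes m :: "nat \<Rightarrow> nat"
  assumes "mono m"
  shows "disjoint_family_on (\<lambda>k. {m k..<m (k + 2)}) {k. even k = b}"
  unfolding disjoint_family_on_def
proof (intro ballI impI)
  fix k l :: nat assume kl: "k \<in> {k. even k = b}" "l \<in> {k. even k = b}" "k \<noteq> l"
  then have "k \<noteq> Suc l" "l \<noteq> Suc k" by auto
  with kl(3) have "k + 2 \<le> l \<or> l + 2 \<le> k" by linarith
  then have "m (k + 2) \<le> m l \<or> m (l + 2) \<le> m k" using monoD[OF assms] by blast
  then show "{m k..<m (k + 2)} \<inter> {m l..<m (l + 2)} = {}" by auto
qed

section \<open>Contradiction between stationary humps and weak convergence\<close>

theorem theorem3p5: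
  fixes F :: "nat filter"
  assumes "free_filter F"
    and "diagonal_filter F"
    and "block_respecting F"
  shows "schur_filter F"
  unfolding schur_filter_def
proof (intro allI impI)
  fix x :: "nat \<Rightarrow> ell1"
  assume "limitin weak_topology x 0 F"
  then have weak: "((\<lambda>n. f (x n)) \<longlongrightarrow> 0) F" if "bounded_linear f" for f :: "ell1 \<Rightarrow> real"
    using limitin_weak_topology_imp_tendsto[of x 0 F f] that
    by (simp add: linear_simps(3))
  show "((\<lambda>n. norm (x n)) \<longlongrightarrow> 0) F"
  proof (rule ccontr)
    assume "\<not> ?thesis"
    then obtain e where e: "0 < e" "\<not> (\<forall>\<^sub>F n in F. norm (x n) < e)"
      by (auto simp: tendsto_iff)
    define I where "I = {n. e \<le> norm (x n)}"
    have I: "I \<in> stationary_sets F"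
      using e(2) by (simp add: I_def stationary_sets_iff_frequently frequently_def not_le)
    \<comment> \<open>The constant \<open>e / 8\<close> bounds both the head and the tail; by
      \<open>suminf_signs_ge\<close> they cost at most \<open>2 * (e / 8 + e / 8) = e / 2\<close> of
      a norm that is at least \<open>e\<close>.\<close>
    define A where "A p = {n. (\<Sum>i<p. \<bar>coord (x n) i\<bar>) < e / 8}" for p
    have "decseq A"
    proof (rule decseq_SucI)
      show "A (Suc p) \<subseteq> A p" for p
        unfolding A_def by (auto intro: order.strict_trans1[rotated])
    qed
    moreover have "A p \<in> filter_sets F" for p
    proof -
      \<comment> \<open>Coordinates are bounded functionals, so weak convergence makes each finite
        head tend to 0 along \<open>F\<close>.\<close>
      have "((\<lambda>n. \<Sum>i<p. \<bar>coord (x n) i\<bar>) \<longlongrightarrow> 0) F"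
        by (intro tendsto_null_sum tendsto_rabs_zero weak bounded_linear_coord)
      then show ?thesis
        using e(1) order_tendstoD(2)[of _ 0 F "e / 8"] by (simp add: A_def filter_sets_def)
    qed
    ultimately obtain J where J: "J \<in> stationary_sets F" "J \<subseteq> I" "\<And>p. finite (J - A p)"
      using assms(2) I unfolding diagonal_filter_def by blast
    \<comment> \<open>Diagonality has turned smallness along \<open>F\<close> into smallness for all
      but finitely many elements of \<open>J\<close>, as the gliding hump requires.\<close>
    have small: "finite {j\<in>J. \<not> (\<Sum>i<p. \<bar>coord (x j) i\<bar>) < e / 8}" for p
      using J(3)[of p] by (simp add: A_def set_diff_eq)
    have "0 < e / 8" using e(1) by simp
    obtain D m where D: "blocking J D" and m: "mono m"
      and head: "\<And>k j. j \<in> D k \<Longrightarrow> (\<Sum>i<m k. \<bar>coord (x j) i\<bar>) < e / 8"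
      and tail: "\<And>k j. j \<in> D k \<Longrightarrow> (\<Sum>i. \<bar>coord (x j) (i + m (k + 2))\<bar>) < e / 8"
      using ex_gliding_hump_blocking[OF infinite_stationary[OF assms(1) J(1)] \<open>0 < e / 8\<close> small]
      by blast
    obtain S where S: "S \<in> stationary_sets F" "S \<subseteq> J" "\<And>k. card (S \<inter> D k) = 1"
      using assms(3) J(1) D unfolding block_respecting_def by blast
    then have "\<exists>j. S \<inter> D k = {j}" for k by (metis card_1_singletonE)
    then obtain s where s: "\<And>k. S \<inter> D k = {s k}" by metis
    \<comment> \<open>The blocks cover \<open>J\<close>, so choosing the point of \<open>S\<close>
      in each block exhausts \<open>S\<close>. Splitting by the parity of the block index then
      leaves a stationary half.\<close>
    have "S \<subseteq> range s"
    proof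
      fix j assume "j \<in> S"
      then obtain k where "j \<in> D k" using S(2) D by (auto simp: blocking_def)
      with \<open>j \<in> S\<close> s[of k] show "j \<in> range s" by auto
    qed
    then have "\<exists>\<^sub>F n in F. n \<in> s ` {k. even k = True} \<or> n \<in> s ` {k. even k = False}"
      using S(1) unfolding stationary_sets_iff_frequently
      by (auto elim!: frequently_elim1)
    then obtain b where b: "\<exists>\<^sub>F n in F. n \<in> s ` {k. even k = b}"
      unfolding frequently_disj_iff by blast
    \<comment> \<open>A single sequence \<open>a\<close> serves all blocks of parity
      \<open>b\<close>, whose windows are disjoint, so it defines one functional independent of
      \<open>k\<close>.\<close>
    obtain a where a: "\<And>i. \<bar>a i\<bar> \<le> 1"
      and sgn: "\<And>k i. even k = b \<Longrightarrow> i \<in> {m k..<m (k + 2)} \<Longrightarrow> a i = sgn (coord (x (s k)) i)"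
      using ex_signs_on_disjoint[OF disjoint_family_on_same_parity[OF m, of b],
          of "\<lambda>k. coord (x (s k))"] by auto
    have large: "e / 2 \<le> (\<Sum>i. a i * coord (x (s k)) i)" if k: "even k = b" for k
    proof -
      have sk: "s k \<in> D k" "s k \<in> S" using s[of k] by auto
      then have "e \<le> norm (x (s k))" using S(2) J(2) by (auto simp: I_def)
      moreover have "m k \<le> m (k + 2)" by (intro monoD[OF m]) simp
      then have "norm (x (s k)) - 2 * ((\<Sum>i<m k. \<bar>coord (x (s k)) i\<bar>)
          + (\<Sum>i. \<bar>coord (x (s k)) (i + m (k + 2))\<bar>)) \<le> (\<Sum>i. a i * coord (x (s k)) i)"
        using sgn[OF k] by (intro suminf_signs_ge a) auto
      ultimately show ?thesis using head[OF sk(1)] tail[OF sk(1)] by argo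
    qed
    \<comment> \<open>Weak convergence is now applied to the functional given by \<open>a\<close>;
      it contradicts \<open>large\<close> on the stationary half.\<close>
    have "\<forall>\<^sub>F n in F. (\<Sum>i. a i * coord (x n) i) < e / 2"
      using e(1) by (intro order_tendstoD(2)[OF weak[OF bounded_linear_suminf_coord[OF a]]]) simp
    then have "\<exists>\<^sub>F n in F. n \<in> s ` {k. even k = b} \<and> (\<Sum>i. a i * coord (x n) i) < e / 2"
      by (rule frequently_eventually_frequently[OF b])
    then show False using large by (auto dest!: frequently_ex simp: not_less[symmetric])
  qed
qed

end
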